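(* Let $X$ be a set, $\Lambda$ a uniform Banach space, and let $\mathcal{B}$ be a $\Lambda$-valued RKBS on $X$. Then there exists a unique function $K$ from $X\times X$ to $\mathcal{M}(\Lambda)$ such that (1) $K(x,\cdot)\xi\in\mathcal{B}$ for all $x\in X$ and $\xi\in\Lambda$ (where $K(x,\cdot)\xi$ denotes the function $y\mapsto K(x,y)\xi$); (2) for all $f\in\mathcal{B}$, $x\in X$ and $\xi\in\Lambda$, $[f(x),\xi]_\Lambda=[f,K(x,\cdot)\xi]_{\mathcal{B}}$; (3) for all $x,y\in X$, $\|K(x,y)\|_{\mathcal{M}(\Lambda)}\le\|\delta_x\|_{\mathcal{L}(\mathcal{B},\Lambda)}\,\|\delta_y\|_{\mathcal{L}(\mathcal{B},\Lambda)}$.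
   Context: Banach spaces are over $\mathbb{C}$. A semi-inner product on a Banach space $V$ is a function $[\cdot,\cdot]_V:V\times V\to\mathbb{C}$ that is linear in its first variable, conjugate homogeneous in its second ($[f,\alpha g]_V=\overline{\alpha}[f,g]_V$), positive ($[f,f]_V>0$ for $f\neq0$), and satisfies $|[f,g]_V|\le[f,f]_V^{1/2}[g,g]_V^{1/2}$. It is compatible if $[f,f]_V^{1/2}=\|f\|_V$ for all $f\in V$. $V$ is uniformly convex if for all $\varepsilon>0$ there is $\delta>0$ with $\|f+g\|_V\le2-\delta$ whenever $\|f\|_V=\|g\|_V=1$ and $\|f-g\|_V\ge\varepsilon$. $V$ is uniformly Fréchet differentiable if $\lim_{t\in\mathbb{R},t\to0}(\|f+tg\|_V-\|f\|_V)/t$ exists uniformly over $f,g$ in the unit sphere of $V$. $V$ is called uniform if it is both uniformly convex and uniformly Fréchet differentiable. A uniform Banach space $V$ has a unique compatible semi-inner product (Giles), always denoted $[\cdot,\cdot]_V$. A Banach space of $\Lambda$-valued functions on $X$ is a Banach space $\mathcal{B}$ consisting of functions $X\to\Lambda$ such that $\|f\|_{\mathcal{B}}=0$ iff $f(x)=0$ for all $x\in X$. A $\Lambda$-valued RKBS on $X$ is a Banach space $\mathcal{B}$ of functions from $X$ to $\Lambda$, with both $\mathcal{B}$ and $\Lambda$ uniform, such that for every $x\in X$ the point evaluation $\delta_x:\mathcal{B}\to\Lambda$, $\delta_x(f)=f(x)$, is continuous. For Banach spaces $V_1,V_2$, $\mathcal{M}(V_1,V_2)$ is the set of all (not necessarily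 linear) maps $T:V_1\to V_2$ for which there is $\alpha\ge0$ with $\|Tu\|_{V_2}\le\alpha\|u\|_{V_1}$ for all $u\in V_1$; $\|T\|_{\mathcal{M}(V_1,V_2)}$ is the infimum of such $\alpha$. $\mathcal{M}(V):=\mathcal{M}(V,V)$, and $\mathcal{L}(V_1,V_2)$ is the subset of linear maps in $\mathcal{M}(V_1,V_2)$, with the operator norm. *)

theory Defs
  imports "HOL-Analysis.Analysis" "HOL-Library.Function_Algebras"
begin

text \<open>
  A normed space is carried by a set \<open>points V\<close> of vectors inside an ambient complex vector space.
  Addition is that of the ambient type; \<open>nrm V\<close> is meaningful on \<open>points V\<close> only.
  Carrier sets are needed because a Banach space of functions has its own norm
  and is in general not a type.
\<close>

record 'v cspace =
  points :: "'v set"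
  scl :: "complex \<Rightarrow> 'v \<Rightarrow> 'v"
  nrm :: "'v \<Rightarrow> real"

locale normed_cspace = vector_space "scl V"
  for V :: "('v::ab_group_add) cspace" +
  assumes subspace_points: "subspace (points V)"
    and nrm_nonneg: "f \<in> points V \<Longrightarrow> 0 \<le> nrm V f"
    and nrm_eq_0_iff: "f \<in> points V \<Longrightarrow> nrm V f = 0 \<longleftrightarrow> f = 0"
    and nrm_triangle: "\<lbrakk>f \<in> points V; g \<in> points V\<rbrakk> \<Longrightarrow> nrm V (f + g) \<le> nrm V f + nrm V g"
    and nrm_scl: "f \<in> points V \<Longrightarrow> nrm V (scl V c f) = cmod c * nrm V f"

text \<open>
  The value 0 off the carrier only serves to meet the axioms of \<^locale>\<open>Metric_space\<close>,
  which constrain the distance function on the whole type.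
\<close>

definition nrm_dist :: "('v::ab_group_add) cspace \<Rightarrow> 'v \<Rightarrow> 'v \<Rightarrow> real" where
  "nrm_dist V f g = (if f \<in> points V \<and> g \<in> points V then nrm V (f - g) else 0)"

locale banach_cspace = normed_cspace +
  assumes complete: "Metric_space.mcomplete (points V) (nrm_dist V)"

definition nrm_topology :: "('v::ab_group_add) cspace \<Rightarrow> 'v topology" where
  "nrm_topology V = Metric_space.mtopology (points V) (nrm_dist V)"

definition unit_sphere :: "'v cspace \<Rightarrow> 'v set" where
  "unit_sphere V = {f \<in> points V. nrm V f = 1}"

definition uniformly_convex :: "('v::ab_group_add) cspace \<Rightarrow> bool" where
  "uniformly_convex V \<longleftrightarrow>
     (\<forall>\<epsilon>>0. \<exists>\<delta>>0. \<forall>f\<in>unit_sphere V. \<forall>g\<in>unit_sphere V.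
        nrm V (f - g) \<ge> \<epsilon> \<longrightarrow> nrm V (f + g) \<le> 2 - \<delta>)"

definition uniformly_frechet_differentiable :: "('v::ab_group_add) cspace \<Rightarrow> bool" where
  "uniformly_frechet_differentiable V \<longleftrightarrow>
     (\<exists>G. uniform_limit (unit_sphere V \<times> unit_sphere V)
            (\<lambda>t (f, g). (nrm V (f + scl V (complex_of_real t) g) - nrm V f) / t)
            G (at (0::real)))"

locale uniform_cspace = banach_cspace +
  assumes convex: "uniformly_convex V"
    and differentiable: "uniformly_frechet_differentiable V"

text \<open>
  Functions on a set are extensional (\<open>\<rightarrow>\<^sub>E\<close>), so that two of them are equal
  iff they agree on that set.
\<close>

definition semi_inner_product :: "('v::ab_group_add) cspace \<Rightarrow> ('v \<times> 'v \<Rightarrow> complex) \<Rightarrow> bool" where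
  "semi_inner_product V s \<longleftrightarrow>
     s \<in> points V \<times> points V \<rightarrow>\<^sub>E UNIV \<and>
     (\<forall>f\<in>points V. \<forall>g\<in>points V. \<forall>h\<in>points V. \<forall>a b.
        s (scl V a f + scl V b g, h) = a * s (f, h) + b * s (g, h)) \<and>
     (\<forall>f\<in>points V. \<forall>g\<in>points V. \<forall>a. s (f, scl V a g) = cnj a * s (f, g)) \<and>
     (\<forall>f\<in>points V. f \<noteq> 0 \<longrightarrow> s (f, f) \<in> \<real> \<and> Re (s (f, f)) > 0) \<and>
     (\<forall>f\<in>points V. \<forall>g\<in>points V. cmod (s (f, g)) \<le> sqrt (Re (s (f, f))) * sqrt (Re (s (g, g))))"

definition compatible_sip :: "('v::ab_group_add) cspace \<Rightarrow> ('v \<times> 'v \<Rightarrow> complex) \<Rightarrow> bool" where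
  "compatible_sip V s \<longleftrightarrow>
     semi_inner_product V s \<and> (\<forall>f\<in>points V. sqrt (Re (s (f, f))) = nrm V f)"

text \<open>Well-defined for uniform spaces, where the compatible semi-inner product is unique (Giles).\<close>

definition sip :: "('v::ab_group_add) cspace \<Rightarrow> 'v \<times> 'v \<Rightarrow> complex" where
  "sip V = (THE s. compatible_sip V s)"

definition bounded_maps :: "'u cspace \<Rightarrow> 'v cspace \<Rightarrow> ('u \<Rightarrow> 'v) set" where
  "bounded_maps U V =
     {T \<in> points U \<rightarrow>\<^sub>E points V. \<exists>\<alpha>\<ge>0. \<forall>u\<in>points U. nrm V (T u) \<le> \<alpha> * nrm U u}"

text \<open>For linear maps this is the operator norm.\<close>

definition map_nrm :: "'u cspace \<Rightarrow> 'v cspace \<Rightarrow> ('u \<Rightarrow> 'v) \<Rightarrow> real" where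
  "map_nrm U V T = Inf {\<alpha>. \<alpha> \<ge> 0 \<and> (\<forall>u\<in>points U. nrm V (T u) \<le> \<alpha> * nrm U u)}"

text \<open>
  A function from \<open>X\<close> to \<open>\<Lambda>\<close> is represented by its extension by 0 to the whole type, so that
  pointwise addition and scaling of total functions are the operations of the function space.
\<close>

locale banach_function_space = banach_cspace B
  for X :: "'x set" and \<Lambda> :: "('l::ab_group_add) cspace" and B :: "('x \<Rightarrow> 'l) cspace" +
  assumes codomain: "banach_cspace \<Lambda>"
    and maps_to: "\<lbrakk>f \<in> points B; x \<in> X\<rbrakk> \<Longrightarrow> f x \<in> points \<Lambda>"
    and zero_outside: "\<lbrakk>f \<in> points B; x \<notin> X\<rbrakk> \<Longrightarrow> f x = 0"
    and scl_pointwise: "scl B = (\<lambda>c f x. scl \<Lambda> c (f x))"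
    and nrm_eq_0_iff_vanishes: "f \<in> points B \<Longrightarrow> nrm B f = 0 \<longleftrightarrow> (\<forall>x\<in>X. f x = 0)"

definition point_eval :: "('x \<Rightarrow> 'l) cspace \<Rightarrow> 'x \<Rightarrow> ('x \<Rightarrow> 'l) \<Rightarrow> 'l" where
  "point_eval B x = restrict (\<lambda>f. f x) (points B)"

locale rkbs = banach_function_space X \<Lambda> B + uniform_cspace B
  for X :: "'x set" and \<Lambda> :: "('l::ab_group_add) cspace" and B :: "('x \<Rightarrow> 'l) cspace" +
  assumes codomain_uniform: "uniform_cspace \<Lambda>"
    and point_eval_continuous:
      "x \<in> X \<Longrightarrow> continuous_map (nrm_topology B) (nrm_topology \<Lambda>) (point_eval B x)"

text \<open>The function \<open>K(x,\<cdot>)\<xi>\<close> on \<open>X\<close>, extended by 0.\<close>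

definition kernel_section ::
  "'x set \<Rightarrow> ('x \<times> 'x \<Rightarrow> 'l \<Rightarrow> 'l) \<Rightarrow> 'x \<Rightarrow> 'l \<Rightarrow> 'x \<Rightarrow> 'l::zero" where
  "kernel_section X K x \<xi> = (\<lambda>y. if y \<in> X then K (x, y) \<xi> else 0)"

end

theory Submission
  imports Defs
begin

text \<open>
  By differentiability the norm has at \<open>g \<noteq> 0\<close> a derivative \<open>D g f\<close> in each direction \<open>f\<close>,
  which convexity makes real-linear in \<open>f\<close>. A functional bounded by \<open>\<parallel>g\<parallel>\<close> that takes the value
  \<open>\<parallel>g\<parallel>\<^sup>2\<close> at \<open>g\<close> must have real part \<open>\<parallel>g\<parallel> D g\<close>, so \<open>\<parallel>g\<parallel> (D g f - \<i> D g (\<i> f))\<close> is the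
  only compatible semi-inner product. Uniform convexity and completeness make every bounded
  functional attain its norm, which represents it uniquely as \<open>[\<cdot>, g]\<close>. The section
  \<open>K(x,\<cdot>)\<xi>\<close> is then the representer of \<open>f \<mapsto> [f(x), \<xi>]\<close>, whose norm is at most
  \<open>\<parallel>\<delta>\<^sub>x\<parallel> \<parallel>\<xi>\<parallel>\<close>.
\<close>

section \<open>Elementary norm facts on the carrier and the two central definitions\<close>

context normed_cspace
begin

lemma points_zero [simp]: "0 \<in> points V"
  using subspace_0 subspace_points by blast

lemma points_add [simp]: "f \<in> points V \<Longrightarrow> g \<in> points V \<Longrightarrow> f + g \<in> points V"
  using subspace_add subspace_points by blast

lemma points_diff [simp]: "f \<in> points V \<Longrightarrow> g \<in> points V \<Longrightarrow> f - g \<in> points V"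
  using subspace_diff subspace_points by blast

lemma points_scl [simp]: "f \<in> points V \<Longrightarrow> scl V a f \<in> points V"
  using subspace_scale subspace_points by blast

lemma nrm_zero [simp]: "nrm V 0 = 0"
  using nrm_eq_0_iff by simp

lemma nrm_pos: "f \<in> points V \<Longrightarrow> f \<noteq> 0 \<Longrightarrow> 0 < nrm V f"
  using nrm_nonneg[of f] nrm_eq_0_iff[of f] by linarith

lemma nrm_diff_commute: "f \<in> points V \<Longrightarrow> g \<in> points V \<Longrightarrow> nrm V (f - g) = nrm V (g - f)"
  using nrm_scl[of "g - f" "-1"] by simp

lemma nrm_diff_triangle: "f \<in> points V \<Longrightarrow> g \<in> points V \<Longrightarrow> nrm V f - nrm V g \<le> nrm V (f - g)"
  using nrm_triangle[of "f - g" g] by simp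

lemma normalize_in_unit_sphere:
  assumes "f \<in> points V" "f \<noteq> 0"
  shows "scl V (inverse (of_real (nrm V f))) f \<in> unit_sphere V"
  using assms nrm_pos[OF assms] by (simp add: unit_sphere_def nrm_scl norm_inverse)

sublocale metric: Metric_space "points V" "nrm_dist V"
proof
  fix f g h
  show "0 \<le> nrm_dist V f g"
    by (simp add: nrm_dist_def nrm_nonneg)
  show "nrm_dist V f g = nrm_dist V g f"
    by (simp add: nrm_dist_def nrm_diff_commute)
  assume f: "f \<in> points V" and g: "g \<in> points V"
  then show "nrm_dist V f g = 0 \<longleftrightarrow> f = g"
    by (simp add: nrm_dist_def nrm_eq_0_iff)
  assume h: "h \<in> points V"
  show "nrm_dist V f h \<le> nrm_dist V f g + nrm_dist V g h"
    using nrm_triangle[of "f - g" "g - h"] f g h by (simp add: nrm_dist_def)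
qed

text \<open>At \<open>g = 0\<close> and \<open>f \<noteq> 0\<close> the norm has a kink, so
  \<open>deriv\<close> gives an unspecified value there; the factor \<open>nrm V g\<close> in
  \<open>giles_sip\<close> makes it harmless.\<close>

definition nrm_deriv :: "'v \<Rightarrow> 'v \<Rightarrow> real" where
  "nrm_deriv g f = deriv (\<lambda>t. nrm V (g + scl V (of_real t) f)) 0"

text \<open>Complexification of a real functional: a complex-linear functional with real part
  \<open>R\<close> sends \<open>f\<close> to \<open>R f - \<i> R (\<i> f)\<close>. Here
  \<open>R\<close> is \<open>nrm V g\<close> times the derivative of the norm at
  \<open>g\<close>.\<close>

definition giles_sip :: "'v \<Rightarrow> 'v \<Rightarrow> complex" where
  "giles_sip f g =
     of_real (nrm V g) * (of_real (nrm_deriv g f) - \<i> * of_real (nrm_deriv g (scl V \<i> f)))"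

end

section \<open>Auxiliary facts on derivatives, scalars and norms of maps\<close>

text \<open>The difference \<open>q - p\<close> has a minimum at the contact point, so its
  derivative vanishes there. This turns inequalities between norms into equalities between
  derivatives.\<close>

lemma DERIV_less_eq_at_contact:
  fixes p q :: "real \<Rightarrow> real"
  assumes "(p has_real_derivative a) (at x)" "(q has_real_derivative b) (at x)"
    and "p x = q x" "\<And>t. p t \<le> q t"
  shows "a = b"
proof -
  have "((\<lambda>t. q t - p t) has_real_derivative b - a) (at x)"
    by (intro derivative_intros assms)
  from DERIV_local_min[OF this zero_less_one] show ?thesis
    using assms by simp
qed

text \<open>The scalar \<open>cnj (sgn z)\<close> rotates \<open>z\<close> onto the nonnegative real
  axis, which lets bounds on real parts become bounds on moduli.\<close>

lemma cnj_sgn_mult_self: "cnj (sgn z) * z = of_real (cmod z)"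
proof -
  have "cnj (sgn z) * z = (z * cnj z) / of_real (cmod z)"
    by (simp add: sgn_eq)
  also have "\<dots> = of_real (cmod z)"
    by (simp add: power2_eq_square flip: complex_norm_square)
  finally show ?thesis .
qed

text \<open>The infimum is itself an admissible constant. The witness \<alpha> keeps the set of
  constants nonempty and settles the case \<open>nrm U u = 0\<close>, where no division is
  possible.\<close>

lemma map_nrm_bound:
  assumes \<alpha>: "\<alpha> \<ge> 0" "\<And>u. u \<in> points U \<Longrightarrow> nrm V (T u) \<le> \<alpha> * nrm U u"
    and u: "u \<in> points U" "nrm U u \<ge> 0"
  shows "nrm V (T u) \<le> map_nrm U V T * nrm U u"
proof (cases "nrm U u = 0")
  case True
  then show ?thesis using \<alpha>(2)[OF u(1)] by simp
next
  case False
  then have pos: "nrm U u > 0" using u by simp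
  have "nrm V (T u) / nrm U u \<le> map_nrm U V T"
    unfolding map_nrm_def by (rule cInf_greatest) (use \<alpha> u pos in \<open>auto simp: divide_le_eq\<close>)
  then show ?thesis using pos by (simp add: divide_le_eq)
qed

lemma map_nrm_le:
  assumes "\<alpha> \<ge> 0" "\<And>u. u \<in> points U \<Longrightarrow> nrm V (T u) \<le> \<alpha> * nrm U u"
  shows "map_nrm U V T \<le> \<alpha>"
  unfolding map_nrm_def using assms by (intro cInf_lower bdd_belowI[of _ 0]) auto

lemma map_nrm_nonneg:
  assumes "\<alpha> \<ge> 0" "\<And>u. u \<in> points U \<Longrightarrow> nrm V (T u) \<le> \<alpha> * nrm U u"
  shows "map_nrm U V T \<ge> 0"
  unfolding map_nrm_def using assms by (intro cInf_greatest) auto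

section \<open>Directional derivatives of the norm\<close>

context uniform_cspace
begin

text \<open>Differentiability is given on the unit sphere only. With \<open>u\<close>,
  \<open>v\<close> the normalized \<open>g\<close>, \<open>f\<close> and \<open>a\<close>,
  \<open>b\<close> their norms, \<open>||g + t f|| = a ||u + (t b / a) v||\<close>, and the chain
  rule applies.\<close>

lemma nrm_has_deriv:
  assumes g: "g \<in> points V" "g \<noteq> 0" and f: "f \<in> points V"
  shows "((\<lambda>t. nrm V (g + scl V (of_real t) f)) has_real_derivative nrm_deriv g f) (at 0)"
proof -
  have "\<exists>d. ((\<lambda>t. nrm V (g + scl V (of_real t) f)) has_real_derivative d) (at 0)"
  proof (cases "f = 0")
    case True
    then show ?thesis by (auto intro!: exI derivative_eq_intros)
  next
    case False
    let ?a = "nrm V g" and ?b = "nrm V f"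
    let ?u = "scl V (inverse (of_real ?a)) g" and ?v = "scl V (inverse (of_real ?b)) f"
    have pos: "?a > 0" "?b > 0"
      using nrm_pos f g False by auto
    have uv: "?u \<in> unit_sphere V" "?v \<in> unit_sphere V"
      using normalize_in_unit_sphere f g False by auto
    obtain G where "uniform_limit (unit_sphere V \<times> unit_sphere V)
            (\<lambda>t (f, g). (nrm V (f + scl V (complex_of_real t) g) - nrm V f) / t) G (at (0::real))"
      using differentiable by (auto simp: uniformly_frechet_differentiable_def)
    from tendsto_uniform_limitI[OF this, of "(?u, ?v)"] uv
    have "((\<lambda>t. (nrm V (?u + scl V (of_real t) ?v) - nrm V ?u) / t) \<longlongrightarrow> G (?u, ?v)) (at 0)"
      by simp
    \<comment> \<open>The point 0 is written as \<open>0 * (?b / ?a)\<close> to match the inner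
      function of the chain rule at \<open>t = 0\<close>.\<close>
    then have "((\<lambda>t. nrm V (?u + scl V (of_real t) ?v)) has_real_derivative G (?u, ?v)) (at (0 * (?b / ?a)))"
      by (simp add: DERIV_def)
    from DERIV_chain2[OF this DERIV_cmult_right[OF DERIV_ident]]
    have 1: "((\<lambda>t. ?a * nrm V (?u + scl V (of_real (t * (?b / ?a))) ?v)) has_real_derivative
             ?a * (G (?u, ?v) * (1 * (?b / ?a)))) (at 0)"
      by (intro DERIV_cmult) simp
    have "?a * nrm V (?u + scl V (of_real (t * (?b / ?a))) ?v) = nrm V (g + scl V (of_real t) f)" for t
    proof -
      have "?a * nrm V (?u + scl V (of_real (t * (?b / ?a))) ?v)
          = nrm V (scl V (of_real ?a) (?u + scl V (of_real (t * (?b / ?a))) ?v))"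
        using f g pos by (subst nrm_scl) simp_all
      also have "scl V (of_real ?a) (?u + scl V (of_real (t * (?b / ?a))) ?v) = g + scl V (of_real t) f"
        using pos by (simp add: scale_right_distrib)
      finally show ?thesis .
    qed
    with 1 show ?thesis by auto
  qed
  then show ?thesis
    unfolding nrm_deriv_def by (metis DERIV_imp_deriv)
qed

text \<open>A line that supports a differentiable function at 0 has its slope, so a lower bound on
  the norm determines the derivative exactly.\<close>

lemma nrm_deriv_eqI:
  assumes "g \<in> points V" "g \<noteq> 0" "f \<in> points V"
    and "\<And>t. nrm V g + t * r \<le> nrm V (g + scl V (of_real t) f)"
  shows "nrm_deriv g f = r"
proof -
  have "((\<lambda>t. nrm V g + t * r) has_real_derivative r) (at 0)"
    by (auto intro!: derivative_eq_intros)
  from DERIV_less_eq_at_contact[OF this nrm_has_deriv[OF assms(1-3)]] assms(4)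
  show ?thesis by simp
qed

lemma nrm_deriv_add:
  assumes g: "g \<in> points V" "g \<noteq> 0" and f: "f \<in> points V" and h: "h \<in> points V"
  shows "nrm_deriv g (f + h) = nrm_deriv g f + nrm_deriv g h"
proof -
  let ?p = "\<lambda>f t. nrm V (g + scl V (of_real t) f)"
  \<comment> \<open>By convexity the mean of the norms at step \<open>2t\<close> dominates the norm along \<open>f + h\<close>, with equality at 0.\<close>
  have double: "((\<lambda>t. ?p k (t * 2)) has_real_derivative nrm_deriv g k * (1 * 2)) (at 0)"
    if "k \<in> points V" for k
    by (rule DERIV_chain2[OF _ DERIV_cmult_right[OF DERIV_ident]])
       (use nrm_has_deriv[OF g that] in simp)
  have deriv: "((\<lambda>t. (?p f (t * 2) + ?p h (t * 2)) / 2) has_real_derivative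
          nrm_deriv g f + nrm_deriv g h) (at 0)"
    using DERIV_cdivide[OF DERIV_add[OF double[OF f] double[OF h]], of 2] by (simp add: add_divide_distrib)
  have le: "?p (f + h) t \<le> (?p f (t * 2) + ?p h (t * 2)) / 2" for t
  proof -
    let ?u = "g + scl V (of_real (t * 2)) f" and ?v = "g + scl V (of_real (t * 2)) h"
    have "?u + ?v = scl V 2 g + scl V 2 (scl V (of_real t) (f + h))"
      by (simp add: scale_right_distrib scale_left_distrib[of 1 1, simplified] algebra_simps)
    also have "\<dots> = scl V 2 (g + scl V (of_real t) (f + h))"
      by (simp add: scale_right_distrib)
    finally have "2 * ?p (f + h) t = nrm V (?u + ?v)"
      using f g h by (simp add: nrm_scl)
    also have "\<dots> \<le> nrm V ?u + nrm V ?v"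
      using f g h by (intro nrm_triangle) auto
    finally show ?thesis by simp
  qed
  from DERIV_less_eq_at_contact[OF nrm_has_deriv[OF g points_add[OF f h]] deriv _ le]
  show ?thesis by simp
qed

lemma nrm_deriv_scale_real:
  assumes g: "g \<in> points V" "g \<noteq> 0" and f: "f \<in> points V"
  shows "nrm_deriv g (scl V (of_real c) f) = c * nrm_deriv g f"
proof -
  have "((\<lambda>t. nrm V (g + scl V (of_real (t * c)) f)) has_real_derivative nrm_deriv g f * (1 * c)) (at 0)"
    by (rule DERIV_chain2[OF _ DERIV_cmult_right[OF DERIV_ident]])
       (use nrm_has_deriv[OF assms] in simp)
  from DERIV_imp_deriv[OF this] show ?thesis
    by (simp add: nrm_deriv_def[of g "scl V _ f"])
qed

text \<open>Pull \<open>a\<close> out of the norm: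
  \<open>a g + t f = a (g + t (f / a))\<close>.\<close>

lemma nrm_deriv_scale_left:
  assumes g: "g \<in> points V" "g \<noteq> 0" and f: "f \<in> points V" and a: "a \<noteq> 0"
  shows "nrm_deriv (scl V a g) f = cmod a * nrm_deriv g (scl V (inverse a) f)"
proof -
  have "nrm V (scl V a g + scl V (of_real t) f)
      = cmod a * nrm V (g + scl V (of_real t) (scl V (inverse a) f))" for t
  proof -
    have "scl V a g + scl V (of_real t) f = scl V a (g + scl V (of_real t) (scl V (inverse a) f))"
      using a by (simp add: scale_right_distrib)
    then show ?thesis
      using f g by (simp only: nrm_scl points_add points_scl)
  qed
  moreover have "((\<lambda>t. cmod a * nrm V (g + scl V (of_real t) (scl V (inverse a) f)))
      has_real_derivative cmod a * nrm_deriv g (scl V (inverse a) f)) (at 0)"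
    using f by (intro DERIV_cmult nrm_has_deriv g) simp
  ultimately show ?thesis
    by (simp add: nrm_deriv_def[of "scl V a g"] DERIV_imp_deriv)
qed

text \<open>By the triangle inequality every difference quotient with \<open>t > 0\<close> obeys the
  bound, so the limit from the right does too.\<close>

lemma nrm_deriv_le:
  assumes g: "g \<in> points V" "g \<noteq> 0" and f: "f \<in> points V"
  shows "nrm_deriv g f \<le> nrm V f"
proof (rule tendsto_upperbound)
  show "((\<lambda>t. (nrm V (g + scl V (of_real t) f) - nrm V g) / t) \<longlongrightarrow> nrm_deriv g f) (at_right 0)"
    using nrm_has_deriv[OF assms] unfolding DERIV_def
    by (auto intro: filterlim_mono[OF _ order_refl at_le])
  have "(nrm V (g + scl V (of_real t) f) - nrm V g) / t \<le> nrm V f" if "t > 0" for t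
    using nrm_triangle[of g "scl V (of_real t) f"] f g that
    by (simp add: nrm_scl field_simps)
  then show "\<forall>\<^sub>F t in at_right 0. (nrm V (g + scl V (of_real t) f) - nrm V g) / t \<le> nrm V f"
    by (auto simp: eventually_at_filter)
qed simp

lemma nrm_deriv_self:
  assumes "g \<in> points V" "g \<noteq> 0"
  shows "nrm_deriv g g = nrm V g"
proof (rule nrm_deriv_eqI)
  fix t :: real
  have "g + scl V (of_real t) g = scl V (of_real (1 + t)) g"
    by (simp add: scale_left_distrib)
  then have "nrm V (g + scl V (of_real t) g) = \<bar>1 + t\<bar> * nrm V g"
    using assms by (simp only: nrm_scl norm_of_real)
  moreover have "(1 + t) * nrm V g \<le> \<bar>1 + t\<bar> * nrm V g"
    using assms by (intro mult_right_mono nrm_nonneg) auto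
  ultimately show "nrm V g + t * nrm V g \<le> nrm V (g + scl V (of_real t) g)"
    by (simp add: algebra_simps)
qed (use assms in auto)

text \<open>Since \<open>cmod (1 + t \<i>)\<close> is at least 1, the constant line supports the
  norm in direction \<open>\<i> g\<close>. This makes \<open>giles_sip g g\<close> real.\<close>

lemma nrm_deriv_ii_self:
  assumes "g \<in> points V" "g \<noteq> 0"
  shows "nrm_deriv g (scl V \<i> g) = 0"
proof (rule nrm_deriv_eqI)
  fix t :: real
  have "g + scl V (of_real t) (scl V \<i> g) = scl V (1 + of_real t * \<i>) g"
    by (simp add: scale_left_distrib)
  moreover have "1 \<le> cmod (1 + of_real t * \<i>)"
    using abs_Re_le_cmod[of "1 + of_real t * \<i>"] by simp
  then have "1 * nrm V g \<le> cmod (1 + of_real t * \<i>) * nrm V g"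
    using assms by (intro mult_right_mono nrm_nonneg) auto
  ultimately show "nrm V g + t * 0 \<le> nrm V (g + scl V (of_real t) (scl V \<i> g))"
    using assms by (simp add: nrm_scl)
qed (use assms in auto)

section \<open>The Giles form is the unique compatible semi-inner product\<close>

lemma giles_sip_self: "g \<in> points V \<Longrightarrow> giles_sip g g = of_real ((nrm V g)\<^sup>2)"
  by (cases "g = 0") (auto simp: giles_sip_def nrm_deriv_self nrm_deriv_ii_self power2_eq_square)

lemma giles_sip_zero_right: "giles_sip f 0 = 0"
  by (simp add: giles_sip_def)

lemma giles_sip_add_left:
  assumes "f \<in> points V" "h \<in> points V" "g \<in> points V"
  shows "giles_sip (f + h) g = giles_sip f g + giles_sip h g"
  using assms
proof (cases "g = 0")
  case False
  then show ?thesis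
    using assms by (simp add: giles_sip_def nrm_deriv_add scale_right_distrib ring_distribs)
qed (simp add: giles_sip_zero_right)

text \<open>Real linearity expresses the derivatives along \<open>a f\<close> and
  \<open>\<i> a f\<close> through those along \<open>f\<close> and \<open>\<i> f\<close>; real and
  imaginary parts then agree.\<close>

lemma giles_sip_scl_left:
  assumes f: "f \<in> points V" and g: "g \<in> points V"
  shows "giles_sip (scl V a f) g = a * giles_sip f g"
proof (cases "g = 0")
  case False
  have split: "scl V z f = scl V (of_real (Re z)) f + scl V (of_real (Im z)) (scl V \<i> f)" for z
    by (metis complex_eq scale_left_distrib scale_scale mult.commute)
  have deriv: "nrm_deriv g (scl V z f) = Re z * nrm_deriv g f + Im z * nrm_deriv g (scl V \<i> f)" for z
    by (subst split) (use f g False in \<open>simp add: nrm_deriv_add nrm_deriv_scale_real del: scale_scale\<close>)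
  have "giles_sip (scl V a f) g = of_real (nrm V g) *
     (of_real (nrm_deriv g (scl V a f)) - \<i> * of_real (nrm_deriv g (scl V (\<i> * a) f)))"
    by (simp add: giles_sip_def)
  also have "\<dots> = a * giles_sip f g"
    unfolding giles_sip_def deriv[of a] deriv[of "\<i> * a"] by (simp add: complex_eq_iff algebra_simps)
  finally show ?thesis .
qed (simp add: giles_sip_zero_right)

text \<open>A factor \<open>cmod a\<close> comes from the norm, another from the derivative, and
  \<open>inverse a\<close> from the first argument; their product is \<open>cnj a\<close>.\<close>

lemma giles_sip_scl_right:
  assumes f: "f \<in> points V" and g: "g \<in> points V"
  shows "giles_sip f (scl V a g) = cnj a * giles_sip f g"
proof (cases "g = 0 \<or> a = 0")
  case False
  then have deriv: "nrm_deriv (scl V a g) h = cmod a * nrm_deriv g (scl V (inverse a) h)"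
    if "h \<in> points V" for h
    using that g by (intro nrm_deriv_scale_left) auto
  have swap: "scl V (inverse a) (scl V \<i> f) = scl V \<i> (scl V (inverse a) f)"
    by (simp add: mult.commute)
  have "giles_sip f (scl V a g) = (of_real (cmod a))\<^sup>2 * giles_sip (scl V (inverse a) f) g"
    unfolding giles_sip_def deriv[OF f] deriv[OF points_scl[OF f]] swap nrm_scl[OF g] of_real_mult
    by algebra
  also have "\<dots> = (of_real (cmod a))\<^sup>2 * inverse a * giles_sip f g"
    using f g by (simp add: giles_sip_scl_left)
  also have "(of_real (cmod a))\<^sup>2 * inverse a = cnj a"
    using False by (simp add: complex_norm_square[symmetric] field_simps flip: of_real_power)
  finally show ?thesis .
qed (auto simp: giles_sip_zero_right)

text \<open>Rotate \<open>f\<close> until the value is real and nonnegative; the form then reduces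
  to its real part, which \<open>nrm_deriv_le\<close> bounds.\<close>

lemma giles_sip_bound:
  assumes f: "f \<in> points V" and g: "g \<in> points V"
  shows "cmod (giles_sip f g) \<le> nrm V f * nrm V g"
proof (cases "g = 0")
  case False
  let ?z = "giles_sip f g"
  let ?l = "cnj (sgn ?z)"
  have "cmod ?z = Re (?l * ?z)"
    by (subst cnj_sgn_mult_self) simp
  also have "\<dots> = Re (giles_sip (scl V ?l f) g)"
    using f g by (simp add: giles_sip_scl_left)
  also have "\<dots> = nrm V g * nrm_deriv g (scl V ?l f)"
    by (simp add: giles_sip_def)
  also have "\<dots> \<le> nrm V g * nrm V (scl V ?l f)"
    using f g False by (intro mult_left_mono nrm_deriv_le nrm_nonneg) auto
  \<comment> \<open>Only an inequality, because \<open>sgn\<close> is 0 when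
    \<open>?z = 0\<close>.\<close>
  also have "\<dots> \<le> nrm V g * nrm V f"
    using f g by (intro mult_left_mono) (auto simp: nrm_scl nrm_nonneg norm_sgn)
  finally show ?thesis by (simp add: mult.commute)
qed (simp add: giles_sip_zero_right)

text \<open>
  The real affine minorant \<open>t \<mapsto> Re (L (g + t h))\<close> of \<open>t \<mapsto> \<parallel>g\<parallel> \<parallel>g + t h\<parallel>\<close> touches it
  at \<open>t = 0\<close>, hence has the same slope.
\<close>

lemma functional_eq_giles_sip:
  assumes add: "\<And>f h. f \<in> points V \<Longrightarrow> h \<in> points V \<Longrightarrow> L (f + h) = L f + L h"
    and scl: "\<And>f a. f \<in> points V \<Longrightarrow> L (scl V a f) = a * L f"
    and bound: "\<And>f. f \<in> points V \<Longrightarrow> cmod (L f) \<le> nrm V g * nrm V f"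
    and g: "g \<in> points V" and attained: "L g = of_real ((nrm V g)\<^sup>2)"
    and f: "f \<in> points V"
  shows "L f = giles_sip f g"
proof (cases "g = 0")
  case True
  then show ?thesis using bound[OF f] by (simp add: giles_sip_zero_right)
next
  case False
  then have pos: "nrm V g > 0" using g nrm_pos by blast
  have Re: "Re (L h) = nrm V g * nrm_deriv g h" if h: "h \<in> points V" for h
  proof -
    have "nrm_deriv g h = Re (L h) / nrm V g"
    proof (rule nrm_deriv_eqI[OF g False h])
      fix t :: real
      let ?k = "g + scl V (of_real t) h"
      have "(nrm V g)\<^sup>2 + t * Re (L h) = Re (L ?k)"
        using g h attained by (simp add: add scl)
      also have "\<dots> \<le> nrm V g * nrm V ?k"
        using bound[of ?k] complex_Re_le_cmod[of "L ?k"] g h by simp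
      finally show "nrm V g + t * (Re (L h) / nrm V g) \<le> nrm V ?k"
        using pos by (simp add: field_simps power2_eq_square)
    qed
    then show ?thesis using pos by simp
  qed
  have "L (scl V \<i> f) = \<i> * L f" using f scl by simp
  then have "Im (L f) = - Re (L (scl V \<i> f))" by simp
  then show ?thesis
    using f by (simp add: complex_eq_iff giles_sip_def Re)
qed

text \<open>For fixed \<open>g\<close> in the carrier, \<open>s (_, g)\<close> is linear, bounded by
  \<open>nrm V g\<close>, and attains this bound at \<open>g\<close>, so
  \<open>functional_eq_giles_sip\<close> determines it. Extensionality settles all other
  arguments.\<close>

lemma compatible_sip_unique:
  assumes "compatible_sip V s"
  shows "s = restrict (\<lambda>(f, g). giles_sip f g) (points V \<times> points V)"
proof
  have ext: "s \<in> points V \<times> points V \<rightarrow>\<^sub>E UNIV"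
    and lin: "\<And>f g h a b. f \<in> points V \<Longrightarrow> g \<in> points V \<Longrightarrow> h \<in> points V \<Longrightarrow>
        s (scl V a f + scl V b g, h) = a * s (f, h) + b * s (g, h)"
    and pos: "\<And>f. f \<in> points V \<Longrightarrow> f \<noteq> 0 \<Longrightarrow> s (f, f) \<in> \<real> \<and> Re (s (f, f)) > 0"
    and CS: "\<And>f g. f \<in> points V \<Longrightarrow> g \<in> points V \<Longrightarrow> cmod (s (f, g)) \<le> nrm V f * nrm V g"
    and nrm: "\<And>f. f \<in> points V \<Longrightarrow> sqrt (Re (s (f, f))) = nrm V f"
    using assms unfolding compatible_sip_def semi_inner_product_def by force+
  have self: "s (g, g) = of_real ((nrm V g)\<^sup>2)" if g: "g \<in> points V" for g
  proof (cases "g = 0")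
    case True
    \<comment> \<open>Positivity says nothing at 0, so the value there comes from the Cauchy-Schwarz
      bound.\<close>
    then show ?thesis using CS[of g g] g by simp
  next
    case False
    then have "s (g, g) = of_real (Re (s (g, g)))"
      using pos[OF g] by (simp add: complex_is_Real_iff complex_eq_iff)
    also have "Re (s (g, g)) = (nrm V g)\<^sup>2"
      using pos[OF g False] nrm[OF g] by (metis less_imp_le real_sqrt_pow2)
    finally show ?thesis .
  qed
  fix p
  show "s p = restrict (\<lambda>(f, g). giles_sip f g) (points V \<times> points V) p"
  proof (cases "p \<in> points V \<times> points V")
    case True
    then obtain f g where p: "p = (f, g)" and f: "f \<in> points V" and g: "g \<in> points V" by auto
    have "s (f, g) = giles_sip f g"
    proof (rule functional_eq_giles_sip[where L = "\<lambda>f. s (f, g)"])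
      show "s (f + h, g) = s (f, g) + s (h, g)" if "f \<in> points V" "h \<in> points V" for f h
        using lin[OF that g, of 1 1] by simp
      show "s (scl V a f, g) = a * s (f, g)" if "f \<in> points V" for f a
        using lin[OF that that g, of a 0] by simp
      show "cmod (s (f, g)) \<le> nrm V g * nrm V f" if "f \<in> points V" for f
        using CS[OF that g] by (simp add: mult.commute)
    qed (use f g self in auto)
    then show ?thesis using f g p by simp
  next
    case False
    then show ?thesis using PiE_arb[OF ext False] by simp
  qed
qed

lemma compatible_sip_giles_sip:
  "compatible_sip V (restrict (\<lambda>(f, g). giles_sip f g) (points V \<times> points V))"
proof -
  have "sqrt (Re (giles_sip f f)) = nrm V f" if "f \<in> points V" for f
    using nrm_nonneg[OF that] unfolding giles_sip_self[OF that] Re_complex_of_real by simp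
  moreover have "giles_sip f f \<in> \<real> \<and> Re (giles_sip f f) > 0" if "f \<in> points V" "f \<noteq> 0" for f
    using nrm_pos[OF that] unfolding giles_sip_self[OF that(1)] Re_complex_of_real by simp
  moreover have "giles_sip (scl V a f + scl V b g) h = a * giles_sip f h + b * giles_sip g h"
    if "f \<in> points V" "g \<in> points V" "h \<in> points V" for f g h a b
    using that by (simp add: giles_sip_add_left giles_sip_scl_left)
  ultimately show ?thesis
    unfolding compatible_sip_def semi_inner_product_def
    by (simp add: giles_sip_scl_right giles_sip_bound)
qed

text \<open>Existence and uniqueness evaluate the definite description in \<open>sip\<close>; from
  here on \<open>giles_sip\<close> can stand for it.\<close>

lemma sip_eq_giles_sip:
  assumes "f \<in> points V" "g \<in> points V"
  shows "sip V (f, g) = giles_sip f g"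
proof -
  have "sip V = restrict (\<lambda>(f, g). giles_sip f g) (points V \<times> points V)"
    unfolding sip_def
    by (rule the_equality) (fact compatible_sip_giles_sip, erule compatible_sip_unique)
  with assms show ?thesis by simp
qed

section \<open>Representation of bounded functionals: uniqueness, then existence\<close>

text \<open>Two representers of one functional have equal norm, and the sum of their normalizations
  has norm at least 2. Uniform convexity forbids this for distinct unit vectors.\<close>

lemma giles_sip_right_cancel:
  assumes g: "g \<in> points V" and h: "h \<in> points V"
    and eq: "\<And>f. f \<in> points V \<Longrightarrow> giles_sip f g = giles_sip f h"
  shows "g = h"
proof -
  \<comment> \<open>Testing with \<open>k\<close> gives \<open>||k||^2 = [k, l]\<close>, which is at
    most \<open>||k|| ||l||\<close>.\<close>
  have le: "nrm V k \<le> nrm V l"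
    if "k \<in> points V" "l \<in> points V" "giles_sip k k = giles_sip k l" for k l
  proof (cases "k = 0")
    case False
    have "nrm V k * nrm V k \<le> nrm V k * nrm V l"
      using giles_sip_bound[OF that(1,2)] unfolding that(3)[symmetric] giles_sip_self[OF that(1)]
      by (simp add: power2_eq_square norm_mult)
    then show ?thesis using nrm_pos[OF that(1) False] by simp
  qed (simp add: nrm_nonneg that)
  have N: "nrm V g = nrm V h"
    using le[of g h] le[of h g] g h eq by (metis order_antisym)
  show ?thesis
  proof (cases "g = 0")
    case True
    then show ?thesis using N nrm_eq_0_iff[OF h] by simp
  next
    case False
    then have pos: "nrm V g > 0" using nrm_pos g by blast
    let ?c = "inverse (of_real (nrm V g))"
    let ?u = "scl V ?c g" and ?v = "scl V ?c h"
    have "h \<noteq> 0" using pos N by auto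
    then have uv: "?u \<in> unit_sphere V" "?v \<in> unit_sphere V"
      using normalize_in_unit_sphere[of g] normalize_in_unit_sphere[of h] g h False N by auto
    \<comment> \<open>Here \<open>[h, g] = [h, h]\<close> by \<open>eq\<close>, and the norms of
      \<open>g\<close> and \<open>h\<close> agree.\<close>
    have "giles_sip (g + h) g = of_real (2 * (nrm V g)\<^sup>2)"
      using g h eq[of h] N by (simp add: giles_sip_add_left giles_sip_self)
    then have "2 * (nrm V g)\<^sup>2 \<le> nrm V (g + h) * nrm V g"
      using giles_sip_bound[of "g + h" g] g h by (simp add: norm_mult norm_power)
    then have "2 * nrm V g \<le> nrm V (g + h)"
      using pos by (simp add: power2_eq_square)
    moreover have "nrm V (?u + ?v) = nrm V (g + h) / nrm V g"
      using g h pos by (simp add: nrm_scl norm_inverse divide_inverse mult.commute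
        flip: scale_right_distrib)
    ultimately have ge: "2 \<le> nrm V (?u + ?v)"
      using pos by (simp only: pos_le_divide_eq)
    have "nrm V (?u - ?v) = 0"
    proof (rule ccontr)
      assume "nrm V (?u - ?v) \<noteq> 0"
      then have "nrm V (?u - ?v) > 0"
        using nrm_nonneg[of "?u - ?v"] g h by (simp add: less_le)
      then obtain \<delta> where "\<delta> > 0" "nrm V (?u + ?v) \<le> 2 - \<delta>"
        using convex uv unfolding uniformly_convex_def by blast
      with ge show False by simp
    qed
    then have "?u = ?v" using nrm_eq_0_iff[of "?u - ?v"] g h by simp
    then show ?thesis using pos by simp
  qed
qed

text \<open>Completeness restated in terms of the norm, free of the off-carrier convention of
  \<open>nrm_dist\<close>.\<close>

lemma Cauchy_sequence_converges:
  assumes mem: "\<And>n. u n \<in> points V"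
    and Cauchy: "\<And>\<epsilon>. \<epsilon> > 0 \<Longrightarrow> \<exists>M. \<forall>n\<ge>M. \<forall>m\<ge>M. nrm V (u n - u m) < \<epsilon>"
  obtains l where "l \<in> points V" "(\<lambda>n. nrm V (u n - l)) \<longlonglongrightarrow> 0"
proof -
  have "metric.MCauchy u"
    unfolding metric.MCauchy_def using mem Cauchy by (auto simp: nrm_dist_def)
  then obtain l where lim: "limitin metric.mtopology u l sequentially"
    using complete unfolding metric.mcomplete_def by blast
  then have "l \<in> points V" "(\<lambda>n. nrm_dist V (u n) l) \<longlonglongrightarrow> 0"
    by (auto simp: metric.limitin_metric_dist_null)
  with mem show thesis
    by (intro that[of l]) (simp_all add: nrm_dist_def)
qed

text \<open>Uniform convexity forces a norming sequence of the functional to converge.\<close>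

theorem riesz_representation:
  assumes add: "\<And>f h. f \<in> points V \<Longrightarrow> h \<in> points V \<Longrightarrow> L (f + h) = L f + L h"
    and scl: "\<And>f a. f \<in> points V \<Longrightarrow> L (scl V a f) = a * L f"
    and bounded: "\<And>f. f \<in> points V \<Longrightarrow> cmod (L f) \<le> C * nrm V f"
  shows "\<exists>g\<in>points V. \<forall>f\<in>points V. L f = giles_sip f g"
proof (cases "\<forall>f\<in>points V. L f = 0")
  case True
  then show ?thesis by (intro bexI[of _ 0]) (auto simp: giles_sip_zero_right)
next
  case False
  \<comment> \<open>The operator norm of \<open>L\<close>; the aim is a unit vector \<open>l\<close>
    with \<open>L l = N\<close>.\<close>
  define N where "N = (SUP f\<in>unit_sphere V. cmod (L f))"
  have sphere_points: "f \<in> points V" "nrm V f = 1" if "f \<in> unit_sphere V" for f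
    using that by (auto simp: unit_sphere_def)
  have bdd: "bdd_above ((\<lambda>f. cmod (L f)) ` unit_sphere V)"
    using bounded by (intro bdd_aboveI[of _ C]) (force simp: unit_sphere_def)
  have L_zero: "L 0 = 0"
    using scl[of 0 0] by simp
  have le_N: "cmod (L f) \<le> N * nrm V f" if f: "f \<in> points V" for f
  proof (cases "f = 0")
    case True
    then show ?thesis by (simp add: L_zero)
  next
    case False
    from cSUP_upper[OF normalize_in_unit_sphere[OF f False] bdd] nrm_pos[OF f False]
    show ?thesis
      by (simp add: N_def scl[OF f] norm_mult norm_divide field_simps)
  qed
  obtain f0 where f0: "f0 \<in> points V" "L f0 \<noteq> 0"
    using False by blast
  then have "f0 \<noteq> 0" using L_zero by auto
  have "0 < N * nrm V f0"
    using le_N[OF f0(1)] f0(2) by (smt (verit) zero_less_norm_iff)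
  then have N: "N > 0"
    using nrm_nonneg[OF f0(1)] by (simp add: zero_less_mult_iff)
  have "\<exists>u\<in>unit_sphere V. N - inverse (real (Suc n)) < Re (L u)" for n
  proof -
    \<comment> \<open>The maximum with 0 forces \<open>L v \<noteq> 0\<close>, so that rotating by
      \<open>cnj (sgn (L v))\<close> preserves the norm of \<open>v\<close>.\<close>
    have "max 0 (N - inverse (real (Suc n))) < N" using N by simp
    moreover have "unit_sphere V \<noteq> {}"
      using normalize_in_unit_sphere[OF f0(1) \<open>f0 \<noteq> 0\<close>] by blast
    ultimately obtain v where v: "v \<in> unit_sphere V" "max 0 (N - inverse (real (Suc n))) < cmod (L v)"
      unfolding N_def using less_cSUP_iff[OF _ bdd] by blast
    then have "L v \<noteq> 0" by auto
    let ?u = "scl V (cnj (sgn (L v))) v"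
    have "?u \<in> unit_sphere V"
      using sphere_points[OF v(1)] \<open>L v \<noteq> 0\<close> by (simp add: unit_sphere_def nrm_scl norm_sgn)
    moreover have "Re (L ?u) = cmod (L v)"
      unfolding scl[OF sphere_points(1)[OF v(1)]] cnj_sgn_mult_self by simp
    ultimately show ?thesis using v by (intro bexI[of _ ?u]) auto
  qed
  then obtain u where u: "\<And>n. u n \<in> unit_sphere V" "\<And>n. N - inverse (real (Suc n)) < Re (L (u n))"
    by metis
  note [simp] = sphere_points[OF u(1)]
  obtain l where l: "l \<in> points V" "(\<lambda>n. nrm V (u n - l)) \<longlonglongrightarrow> 0"
  proof (rule Cauchy_sequence_converges)
    fix \<epsilon> :: real assume "\<epsilon> > 0"
    then obtain \<delta> where \<delta>: "\<delta> > 0"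
      "\<And>f g. f \<in> unit_sphere V \<Longrightarrow> g \<in> unit_sphere V \<Longrightarrow> nrm V (f - g) \<ge> \<epsilon> \<Longrightarrow> nrm V (f + g) \<le> 2 - \<delta>"
      using convex unfolding uniformly_convex_def by meson
    \<comment> \<open>Two values above \<open>N - N * \<delta> / 2\<close> sum to more than
      \<open>N * (2 - \<delta>)\<close>, the bound that convexity would impose on vectors at
      distance at least \<epsilon>.\<close>
    then obtain M where M: "inverse (real (Suc M)) < N * \<delta> / 2"
      using N reals_Archimedean[of "N * \<delta> / 2"] by auto
    have "nrm V (u n - u m) < \<epsilon>" if "n \<ge> M" "m \<ge> M" for n m
    proof (rule ccontr)
      have close: "N - N * \<delta> / 2 < Re (L (u k))" if "k \<ge> M" for k
      proof -
        have "inverse (real (Suc k)) \<le> inverse (real (Suc M))"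
          using that by (intro le_imp_inverse_le) auto
        with M u(2)[of k] show ?thesis by linarith
      qed
      assume "\<not> nrm V (u n - u m) < \<epsilon>"
      then have "nrm V (u n + u m) \<le> 2 - \<delta>"
        using \<delta>(2) u(1) by simp
      then have "N * nrm V (u n + u m) \<le> N * (2 - \<delta>)"
        using N by (intro mult_left_mono) auto
      moreover have "Re (L (u n)) + Re (L (u m)) \<le> N * nrm V (u n + u m)"
        using le_N[of "u n + u m"] complex_Re_le_cmod[of "L (u n + u m)"] by (simp add: add)
      ultimately show False
        using close[OF that(1)] close[OF that(2)] by (simp add: algebra_simps)
    qed
    then show "\<exists>M. \<forall>n\<ge>M. \<forall>m\<ge>M. nrm V (u n - u m) < \<epsilon>" by blast
  qed simp
  have "(\<lambda>n. nrm V (u n) - nrm V l) \<longlonglongrightarrow> 0"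
  proof (rule Lim_null_comparison[OF _ l(2)])
    show "\<forall>\<^sub>F n in sequentially. norm (nrm V (u n) - nrm V l) \<le> nrm V (u n - l)"
      using nrm_diff_triangle[of _ l] nrm_diff_triangle[of l] l(1) nrm_diff_commute[of l]
      by (intro always_eventually allI) (simp add: abs_le_iff, smt (verit) sphere_points u(1))
  qed
  then have l_nrm: "nrm V l = 1"
    by (simp add: LIMSEQ_const_iff)
  have "(\<lambda>n. L (u n) - L l) \<longlonglongrightarrow> 0"
  proof (rule Lim_null_comparison)
    show "\<forall>\<^sub>F n in sequentially. norm (L (u n) - L l) \<le> N * nrm V (u n - l)"
    proof (intro always_eventually allI)
      fix n
      have "L (u n) = L (u n - l) + L l"
        using add[of "u n - l" l] l(1) by simp
      then show "norm (L (u n) - L l) \<le> N * nrm V (u n - l)"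
        using le_N[of "u n - l"] l(1) by simp
    qed
    show "(\<lambda>n. N * nrm V (u n - l)) \<longlonglongrightarrow> 0"
      using tendsto_mult_left[OF l(2), of N] by simp
  qed
  then have lim_Re: "(\<lambda>n. Re (L (u n))) \<longlonglongrightarrow> Re (L l)"
    by (intro tendsto_Re) (simp add: LIM_zero_iff)
  have "(\<lambda>n. N - inverse (real (Suc n))) \<longlonglongrightarrow> N - 0"
    by (intro tendsto_intros LIMSEQ_inverse_real_of_nat)
  then have "N - 0 \<le> Re (L l)"
    by (rule LIMSEQ_le[OF _ lim_Re]) (intro exI[of _ 0] allI impI less_imp_le u(2))
  moreover have "cmod (L l) \<le> N"
    using le_N[OF l(1)] l_nrm by simp
  \<comment> \<open>The chain \<open>N \<le> Re (L l) \<le> cmod (L l) \<le> N\<close> collapses, so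
    \<open>L l\<close> has no imaginary part.\<close>
  ultimately have "Re (L l) = N" "cmod (L l) = Re (L l)"
    using complex_Re_le_cmod[of "L l"] by linarith+
  then have L_l: "L l = of_real N"
    using cmod_power2[of "L l"] by (simp add: complex_eq_iff)
  \<comment> \<open>Scaling by \<open>N\<close> makes the norm of \<open>?g\<close> equal to that of
    \<open>L\<close> and gives \<open>L ?g = N^2\<close>, as \<open>functional_eq_giles_sip\<close>
    demands.\<close>
  let ?g = "scl V (of_real N) l"
  have g: "?g \<in> points V" and g_nrm: "nrm V ?g = N"
    using l(1) l_nrm N by (simp_all add: nrm_scl)
  have "L ?g = of_real ((nrm V ?g)\<^sup>2)"
    unfolding g_nrm scl[OF l(1)] L_l by (simp add: power2_eq_square)
  then have "L f = giles_sip f ?g" if "f \<in> points V" for f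
    using g that le_N by (intro functional_eq_giles_sip add scl) (simp_all only: g_nrm)
  with g show ?thesis by blast
qed

end

section \<open>Point evaluations and the representers they induce\<close>

context rkbs
begin

sublocale codomain: uniform_cspace \<Lambda>
  by (rule codomain_uniform)

text \<open>Continuity at 0 bounds evaluation on a ball of radius \<delta>; homogeneity extends the
  bound to the whole space.\<close>

lemma point_eval_bounded:
  assumes x: "x \<in> X"
  obtains C where "C \<ge> 0" "\<And>f. f \<in> points B \<Longrightarrow> nrm \<Lambda> (f x) \<le> C * nrm B f"
proof -
  have "\<forall>a\<in>points B. \<forall>\<epsilon>>0. \<exists>\<delta>>0. \<forall>f. f \<in> points B \<and> nrm_dist B a f < \<delta> \<longrightarrow>
      nrm_dist \<Lambda> (point_eval B x a) (point_eval B x f) < \<epsilon>"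
    using point_eval_continuous[OF x]
    unfolding nrm_topology_def metric.metric_continuous_map[OF codomain.metric.Metric_space_axioms]
    by blast
  from this[rule_format, OF points_zero zero_less_one]
  obtain \<delta> where \<delta>: "\<delta> > 0"
    "\<And>f. f \<in> points B \<Longrightarrow> nrm_dist B 0 f < \<delta> \<Longrightarrow> nrm_dist \<Lambda> (point_eval B x 0) (point_eval B x f) < 1"
    by blast
  have near: "nrm \<Lambda> (f x) < 1" if f: "f \<in> points B" "nrm B f < \<delta>" for f
    using \<delta>(2)[of f] f maps_to[OF f(1) x] nrm_diff_commute[of 0 f] codomain.nrm_diff_commute[of 0 "f x"]
    by (simp add: nrm_dist_def point_eval_def)
  show thesis
  proof (rule that[of "2 / \<delta>"])
    fix f assume f: "f \<in> points B"
    show "nrm \<Lambda> (f x) \<le> 2 / \<delta> * nrm B f"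
    proof (cases "f = 0")
      case False
      then have pos: "nrm B f > 0" using f nrm_pos by blast
      \<comment> \<open>Rescaling to norm \<open>\<delta> / 2\<close> stays strictly inside the
        ball, whence the constant \<open>2 / \<delta>\<close>.\<close>
      let ?c = "\<delta> / (2 * nrm B f)"
      have "nrm B (scl B (of_real ?c) f) < \<delta>"
        unfolding nrm_scl[OF f] norm_of_real using pos \<delta>(1) by simp
      then have "nrm \<Lambda> (scl \<Lambda> (of_real ?c) (f x)) < 1"
        using near[OF points_scl[OF f]] by (simp add: scl_pointwise)
      then have "?c * nrm \<Lambda> (f x) < 1"
        unfolding codomain.nrm_scl[OF maps_to[OF f x]] norm_of_real using pos \<delta>(1) by simp
      then show ?thesis using pos \<delta>(1) by (simp add: field_simps)
    qed simp
  qed (use \<delta>(1) in simp)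
qed

lemma nrm_point_eval_le:
  assumes "x \<in> X" "f \<in> points B"
  shows "nrm \<Lambda> (f x) \<le> map_nrm B \<Lambda> (point_eval B x) * nrm B f"
proof -
  obtain C where "C \<ge> 0" "\<And>f. f \<in> points B \<Longrightarrow> nrm \<Lambda> (f x) \<le> C * nrm B f"
    using point_eval_bounded assms by blast
  with map_nrm_bound[of C B \<Lambda> "point_eval B x" f] assms nrm_nonneg show ?thesis
    by (simp add: point_eval_def)
qed

lemma map_nrm_point_eval_nonneg:
  assumes "x \<in> X"
  shows "map_nrm B \<Lambda> (point_eval B x) \<ge> 0"
proof -
  obtain C where "C \<ge> 0" "\<And>f. f \<in> points B \<Longrightarrow> nrm \<Lambda> (f x) \<le> C * nrm B f"
    using point_eval_bounded assms by blast
  then show ?thesis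
    by (intro map_nrm_nonneg[of C]) (auto simp: point_eval_def)
qed

lemma representer_exists:
  assumes x: "x \<in> X" and \<xi>: "\<xi> \<in> points \<Lambda>"
  shows "\<exists>g\<in>points B. \<forall>f\<in>points B. sip \<Lambda> (f x, \<xi>) = sip B (f, g)"
proof -
  let ?L = "\<lambda>f. codomain.giles_sip (f x) \<xi>"
  have "\<exists>g\<in>points B. \<forall>f\<in>points B. ?L f = giles_sip f g"
  proof (rule riesz_representation)
    fix f assume f: "f \<in> points B"
    note fx = maps_to[OF f x]
    show "?L (scl B a f) = a * ?L f" for a
      using fx \<xi> by (simp add: scl_pointwise codomain.giles_sip_scl_left)
    show "?L (f + h) = ?L f + ?L h" if "h \<in> points B" for h
      using fx maps_to[OF that x] \<xi> by (simp add: codomain.giles_sip_add_left)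
    have "cmod (?L f) \<le> nrm \<Lambda> (f x) * nrm \<Lambda> \<xi>"
      using fx \<xi> by (rule codomain.giles_sip_bound)
    also have "\<dots> \<le> (map_nrm B \<Lambda> (point_eval B x) * nrm B f) * nrm \<Lambda> \<xi>"
      using nrm_point_eval_le[OF x f] codomain.nrm_nonneg[OF \<xi>] by (rule mult_right_mono)
    finally show "cmod (?L f) \<le> (map_nrm B \<Lambda> (point_eval B x) * nrm \<Lambda> \<xi>) * nrm B f"
      by (simp add: mult_ac)
  qed
  then show ?thesis
    using x \<xi> by (simp add: sip_eq_giles_sip codomain.sip_eq_giles_sip maps_to)
qed

text \<open>Test the representation at \<open>f = g\<close>: \<open>||g||^2 = [g(x), \<xi>]\<close>
  is at most \<open>||\<delta>_x|| ||g|| ||\<xi>||\<close>; then cancel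
  \<open>||g||\<close>.\<close>

lemma representer_nrm_le:
  assumes x: "x \<in> X" and \<xi>: "\<xi> \<in> points \<Lambda>" and g: "g \<in> points B"
    and repr: "\<And>f. f \<in> points B \<Longrightarrow> sip \<Lambda> (f x, \<xi>) = sip B (f, g)"
  shows "nrm B g \<le> map_nrm B \<Lambda> (point_eval B x) * nrm \<Lambda> \<xi>"
proof (cases "g = 0")
  case True
  then show ?thesis
    using map_nrm_point_eval_nonneg[OF x] codomain.nrm_nonneg[OF \<xi>] by simp
next
  case False
  have "giles_sip g g = codomain.giles_sip (g x) \<xi>"
    using repr[OF g] g \<xi> maps_to[OF g x] by (simp add: sip_eq_giles_sip codomain.sip_eq_giles_sip)
  then have "(nrm B g)\<^sup>2 \<le> nrm \<Lambda> (g x) * nrm \<Lambda> \<xi>"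
    using codomain.giles_sip_bound[OF maps_to[OF g x] \<xi>]
    by (metis giles_sip_self[OF g] norm_of_real abs_power2)
  also have "\<dots> \<le> (map_nrm B \<Lambda> (point_eval B x) * nrm B g) * nrm \<Lambda> \<xi>"
    using nrm_point_eval_le[OF x g] codomain.nrm_nonneg[OF \<xi>] by (rule mult_right_mono)
  finally have "nrm B g * nrm B g \<le> nrm B g * (map_nrm B \<Lambda> (point_eval B x) * nrm \<Lambda> \<xi>)"
    by (simp add: power2_eq_square mult_ac)
  then show ?thesis using nrm_pos[OF g False] by simp
qed

end

section \<open>Construction and uniqueness of the reproducing kernel\<close>

theorem theorem2p3:
  fixes X :: "'x set" and \<Lambda> :: "('l::ab_group_add) cspace" and B :: "('x \<Rightarrow> 'l) cspace"
  assumes "uniform_cspace \<Lambda>" and "rkbs X \<Lambda> B"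
  shows "\<exists>!K. K \<in> X \<times> X \<rightarrow>\<^sub>E bounded_maps \<Lambda> \<Lambda> \<and>
    (\<forall>x\<in>X. \<forall>\<xi>\<in>points \<Lambda>. kernel_section X K x \<xi> \<in> points B) \<and>
    (\<forall>f\<in>points B. \<forall>x\<in>X. \<forall>\<xi>\<in>points \<Lambda>.
       sip \<Lambda> (f x, \<xi>) = sip B (f, kernel_section X K x \<xi>)) \<and>
    (\<forall>x\<in>X. \<forall>y\<in>X. map_nrm \<Lambda> \<Lambda> (K (x, y)) \<le>
       map_nrm B \<Lambda> (point_eval B x) * map_nrm B \<Lambda> (point_eval B y))"
proof -
  interpret rkbs X \<Lambda> B by fact
  obtain k where k: "\<And>x \<xi>. x \<in> X \<Longrightarrow> \<xi> \<in> points \<Lambda> \<Longrightarrow> k x \<xi> \<in> points B"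
    and repr: "\<And>x \<xi> f. x \<in> X \<Longrightarrow> \<xi> \<in> points \<Lambda> \<Longrightarrow> f \<in> points B \<Longrightarrow>
      sip \<Lambda> (f x, \<xi>) = sip B (f, k x \<xi>)"
    using representer_exists by metis
  \<comment> \<open>Restriction in the pair and in \<xi> makes \<open>K\<close> and each of its
    values extensional, as the function spaces of the statement require.\<close>
  define K where "K = (\<lambda>(x, y)\<in>X \<times> X. \<lambda>\<xi>\<in>points \<Lambda>. k x \<xi> y)"
  \<comment> \<open>Outside \<open>X\<close> both sides are 0, since members of \<open>B\<close>
    vanish there.\<close>
  have kernel_section_K: "kernel_section X K x \<xi> = k x \<xi>" if "x \<in> X" "\<xi> \<in> points \<Lambda>" for x \<xi>
    using that zero_outside[OF k[OF that]] by (auto simp: kernel_section_def K_def)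
  let ?n = "\<lambda>x. map_nrm B \<Lambda> (point_eval B x)"
  have K_le: "nrm \<Lambda> (K (x, y) \<xi>) \<le> (?n x * ?n y) * nrm \<Lambda> \<xi>"
    if x: "x \<in> X" and y: "y \<in> X" and \<xi>: "\<xi> \<in> points \<Lambda>" for x y \<xi>
  proof -
    \<comment> \<open>Evaluating the representer at \<open>y\<close> contributes the norm of
      evaluation at \<open>y\<close>; the norm of the representer contributes that at
      \<open>x\<close>.\<close>
    have "nrm \<Lambda> (K (x, y) \<xi>) \<le> ?n y * nrm B (k x \<xi>)"
      using nrm_point_eval_le[OF y k[OF x \<xi>]] x y \<xi> by (simp add: K_def)
    also have "\<dots> \<le> ?n y * (?n x * nrm \<Lambda> \<xi>)"
      by (intro mult_left_mono representer_nrm_le map_nrm_point_eval_nonneg x y \<xi> k repr)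
    finally show ?thesis by (simp add: mult_ac)
  qed
  have n_nonneg: "0 \<le> ?n x * ?n y" if "x \<in> X" "y \<in> X" for x y
    using that by (simp add: map_nrm_point_eval_nonneg)
  show ?thesis
  proof (rule ex1I[of _ K], intro conjI ballI)
    have "K (x, y) \<in> bounded_maps \<Lambda> \<Lambda>" if "x \<in> X" "y \<in> X" for x y
    proof -
      have "K (x, y) \<in> points \<Lambda> \<rightarrow>\<^sub>E points \<Lambda>"
        using that k maps_to by (auto simp: K_def)
      then show ?thesis
        using K_le n_nonneg that unfolding bounded_maps_def by blast
    qed
    then show "K \<in> X \<times> X \<rightarrow>\<^sub>E bounded_maps \<Lambda> \<Lambda>"
      by (auto simp: K_def)
  next
    fix K'
    assume K': "K' \<in> X \<times> X \<rightarrow>\<^sub>E bounded_maps \<Lambda> \<Lambda> \<and>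
      (\<forall>x\<in>X. \<forall>\<xi>\<in>points \<Lambda>. kernel_section X K' x \<xi> \<in> points B) \<and>
      (\<forall>f\<in>points B. \<forall>x\<in>X. \<forall>\<xi>\<in>points \<Lambda>.
         sip \<Lambda> (f x, \<xi>) = sip B (f, kernel_section X K' x \<xi>)) \<and>
      (\<forall>x\<in>X. \<forall>y\<in>X. map_nrm \<Lambda> \<Lambda> (K' (x, y)) \<le> ?n x * ?n y)"
    \<comment> \<open>Both sections represent \<open>f \<mapsto> [f(x), \<xi>]\<close>, so
      cancellation in the second argument identifies them.\<close>
    have eq: "kernel_section X K' x \<xi> = k x \<xi>" if "x \<in> X" "\<xi> \<in> points \<Lambda>" for x \<xi>
    proof (rule giles_sip_right_cancel)
      show "giles_sip f (kernel_section X K' x \<xi>) = giles_sip f (k x \<xi>)" if "f \<in> points B" for f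
        using K' repr[of x \<xi> f] k[of x \<xi>] \<open>x \<in> X\<close> \<open>\<xi> \<in> points \<Lambda>\<close> that
        by (metis sip_eq_giles_sip)
    qed (use K' k that in auto)
    show "K' = K"
    proof
      fix p
      show "K' p = K p"
      proof (cases "p \<in> X \<times> X")
        case True
        then obtain x y where p: "p = (x, y)" "x \<in> X" "y \<in> X" by auto
        have ext: "K' p \<in> points \<Lambda> \<rightarrow>\<^sub>E points \<Lambda>"
          using K' True by (auto simp: bounded_maps_def)
        show ?thesis
        proof
          fix \<xi>
          show "K' p \<xi> = K p \<xi>"
          proof (cases "\<xi> \<in> points \<Lambda>")
            case True
            then show ?thesis
              using fun_cong[OF eq[of x \<xi>], of y] p by (simp add: kernel_section_def K_def)
          next
            case False
            then show ?thesis
              using PiE_arb[OF ext] p by (simp add: K_def)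
          qed
        qed
      next
        case False
        then show ?thesis
          using K' by (metis (no_types, lifting) K_def PiE_arb restrict_apply)
      qed
    qed
  qed (use kernel_section_K k repr K_le n_nonneg in \<open>auto intro!: map_nrm_le\<close>)
qed

end
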